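(* For every integer $n\geq 2$, $b_2(G_{3,n})=2$ if $n\equiv 1\pmod 3$, and $b_2(G_{3,n})=1$ otherwise.
   Context: For a graph $G$, a set $D\subseteq V(G)$ is a $2$-dominating set if every vertex not in $D$ has at least $2$ neighbours in $D$. The $2$-domination number $\gamma_2(G)$ is the minimum cardinality of a $2$-dominating set of $G$. The $2$-bondage number $b_2(G)$ is the minimum cardinality of an edge set $B\subseteq E(G)$ such that $\gamma_2(G-B)>\gamma_2(G)$, where $G-B$ has vertex set $V(G)$ and edge set $E(G)\setminus B$. The grid graph $G_{m,n}=P_m\times P_n$ has vertex set $[m]\times[n]$ (where $[k]=\{1,\dots,k\}$), with $(i,j)$ and $(i',j')$ adjacent iff $|i-i'|+|j-j'|=1$. *)

theory Defs
  imports Main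
begin

text \<open>
  A finite simple graph is given by its vertex set and its set of edges, an edge being
  the two-element set of its endpoints. The invariants below are intended for finite graphs
  only, as \<^const>\<open>card\<close> is 0 on infinite sets.
\<close>

definition fin_simple_graph :: "'a set \<Rightarrow> 'a set set \<Rightarrow> bool" where
  "fin_simple_graph V E \<longleftrightarrow> finite V \<and> E \<subseteq> {e. e \<subseteq> V \<and> card e = 2}"

definition neighbours :: "'a set set \<Rightarrow> 'a \<Rightarrow> 'a set" where
  "neighbours E v = {u. {v, u} \<in> E}"

definition two_dominating :: "'a set \<Rightarrow> 'a set set \<Rightarrow> 'a set \<Rightarrow> bool" where
  "two_dominating V E D \<longleftrightarrow> D \<subseteq> V \<and> (\<forall>v\<in>V - D. card (neighbours E v \<inter> D) \<ge> 2)"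

definition two_domination_number :: "'a set \<Rightarrow> 'a set set \<Rightarrow> nat" where
  "two_domination_number V E = Min {card D | D. two_dominating V E D}"

text \<open>
  The empty edge set never raises the 2-domination number, so a genuine minimum is positive.
  If no edge set raises it, the infimum is over the empty set of naturals and equals 0.
\<close>

definition two_bondage_number :: "'a set \<Rightarrow> 'a set set \<Rightarrow> nat" where
  "two_bondage_number V E =
     Inf {card B | B. B \<subseteq> E \<and> two_domination_number V (E - B) > two_domination_number V E}"

definition grid_verts :: "nat \<Rightarrow> nat \<Rightarrow> (nat \<times> nat) set" where
  "grid_verts m n = {1..m} \<times> {1..n}"

definition grid_edges :: "nat \<Rightarrow> nat \<Rightarrow> (nat \<times> nat) set set" where
  "grid_edges m n = {{(i, j), (i', j')} | i j i' j'.
     (i, j) \<in> grid_verts m n \<and> (i', j') \<in> grid_verts m n \<and>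
     \<bar>int i - int i'\<bar> + \<bar>int j - int j'\<bar> = 1}"

lemma fin_simple_graph_grid: "fin_simple_graph (grid_verts m n) (grid_edges m n)"
  by (auto simp: fin_simple_graph_def grid_verts_def grid_edges_def card_insert_if)

lemma two_dominating_verts: "two_dominating V E V"
  by (simp add: two_dominating_def)

lemma finite_two_dominating_cards:
  assumes "finite V"
  shows "finite {card D | D. two_dominating V E D}"
proof (rule finite_subset)
  show "{card D | D. two_dominating V E D} \<subseteq> card ` Pow V"
    by (auto simp: two_dominating_def)
qed (use assms in simp)

end

(*
  Lower bounds come from a dynamic program over the columns: a potential, read off from two
  consecutive columns, bounds 3c - 4m from below, where c is the number of dominating vertices in
  the m columns still to come. In the grid this yields 3|D| >= 4n, but 3|D| >= 4n + 2 once
  the edge (1,1)(1,2) is removed (then (1,1) is in D and of no use to (1,2)), and 3|D| >= 4n + 4 once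
  the two edges of the first column are removed (then D contains that column). For the upper bounds,
  take columns {2}, {1,3}, {2} periodically. When n = 3k + 1, there is room for one
  additional column {1,3} at any position x = 1 mod 3; the vertices near x are then dominated three
  times, so that placing x close to a given edge makes the removal of this edge harmless.
*)

theory Submission
  imports Defs
begin

section \<open>Basic facts on the 2-domination number and on grids\<close>

lemma two_domination_number_le:
  assumes "finite V" "two_dominating V E D"
  shows "two_domination_number V E \<le> card D"
  unfolding two_domination_number_def
  using finite_two_dominating_cards[OF assms(1)] assms(2) by (intro Min_le) auto

lemma two_domination_number_ge:
  assumes "finite V" "\<And>D. two_dominating V E D \<Longrightarrow> m \<le> card D"
  shows "m \<le> two_domination_number V E"
  unfolding two_domination_number_def
  using finite_two_dominating_cards[OF assms(1), of E] two_dominating_verts[of V E] assms(2)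
  by (subst Min_ge_iff) auto

lemma finite_grid_verts: "finite (grid_verts m n)"
  by (simp add: grid_verts_def)

lemma finite_grid_edges: "finite (grid_edges m n)"
proof -
  have "grid_edges m n \<subseteq> Pow (grid_verts m n)"
    by (auto simp: grid_edges_def)
  then show ?thesis
    by (rule finite_subset) (simp add: finite_grid_verts)
qed

lemma grid_edges_iff:
  "{(i, j), (i', j')} \<in> grid_edges m n \<longleftrightarrow>
     (i, j) \<in> grid_verts m n \<and> (i', j') \<in> grid_verts m n \<and>
     \<bar>int i - int i'\<bar> + \<bar>int j - int j'\<bar> = 1"
proof
  assume "{(i, j), (i', j')} \<in> grid_edges m n"
  then obtain a b c d where *: "{(i, j), (i', j')} = {(a, b), (c, d)}"
    "(a, b) \<in> grid_verts m n" "(c, d) \<in> grid_verts m n" "\<bar>int a - int c\<bar> + \<bar>int b - int d\<bar> = 1"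
    unfolding grid_edges_def by blast
  from *(1) have "(i, j) = (a, b) \<and> (i', j') = (c, d) \<or> (i, j) = (c, d) \<and> (i', j') = (a, b)"
    by (simp only: doubleton_eq_iff)
  then show "(i, j) \<in> grid_verts m n \<and> (i', j') \<in> grid_verts m n \<and>
     \<bar>int i - int i'\<bar> + \<bar>int j - int j'\<bar> = 1"
    using *(2-4) by auto
qed (auto simp: grid_edges_def)

lemma card_subset_grid3:
  assumes "D \<subseteq> grid_verts 3 n"
  shows "card D = (\<Sum>j = 1..n. of_bool ((1, j) \<in> D) + of_bool ((2, j) \<in> D) + of_bool ((3, j) \<in> D))"
proof -
  have "card D = (\<Sum>p \<in> grid_verts 3 n. of_bool (p \<in> D))"
    using assms by (simp add: finite_grid_verts Int_absorb1)
  also have "\<dots> = (\<Sum>i \<in> {1..3}. \<Sum>j = 1..n. of_bool ((i, j) \<in> D))"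
    by (simp add: grid_verts_def sum.cartesian_product del: sum_of_bool_eq)
  also have "{1..3} = {1, 2, 3::nat}"
    by auto
  finally show ?thesis
    by (simp add: sum.distrib del: sum_of_bool_eq)
qed

section \<open>Lower bounds\<close>

text \<open>The conditions are those of the full grid. No case distinction is made at the border:
  the columns 0 and n + 1 contain no vertex of a dominating set, so they contribute 0.\<close>

definition dom_column :: "(nat \<times> nat) set \<Rightarrow> nat \<Rightarrow> bool" where
  "dom_column D j \<longleftrightarrow>
     ((1, j) \<in> D \<or> of_bool ((2, j) \<in> D) + of_bool ((1, j - 1) \<in> D) + of_bool ((1, j + 1) \<in> D) \<ge> (2::nat)) \<and>
     ((2, j) \<in> D \<or> of_bool ((1, j) \<in> D) + of_bool ((3, j) \<in> D)
         + of_bool ((2, j - 1) \<in> D) + of_bool ((2, j + 1) \<in> D) \<ge> (2::nat)) \<and>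
     ((3, j) \<in> D \<or> of_bool ((2, j) \<in> D) + of_bool ((3, j - 1) \<in> D) + of_bool ((3, j + 1) \<in> D) \<ge> (2::nat))"

text \<open>
  The booleans describe membership in \<open>D\<close> for column \<open>j - 1\<close> (primed) and column \<open>j\<close>; \<open>na\<close>, \<open>nb\<close>, \<open>nc\<close> say that
  a vertex of column \<open>j\<close> still needs its right neighbour. The values are the minimum of \<open>3 c - 4 m\<close>
  over all ways to complete the set by \<open>c\<close> vertices in \<open>m\<close> further columns, for arbitrary \<open>m\<close>.
\<close>
definition column_potential :: "bool \<Rightarrow> bool \<Rightarrow> bool \<Rightarrow> bool \<Rightarrow> bool \<Rightarrow> bool \<Rightarrow> int" where
  "column_potential a' b' c' a b c =
     (let na = (\<not> a \<and> \<not> (a' \<and> b)); nc = (\<not> c \<and> \<not> (c' \<and> b));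
          nb = (\<not> b \<and> of_bool a + of_bool c + of_bool b' < (2::nat))
      in if \<not> na \<and> \<not> nc then (if a \<and> c then -1 else 0)
         else if nb then 2 * (of_bool na + of_bool nc)
         else if b \<and> (a \<or> c) then 0 else 1)"

definition potential :: "(nat \<times> nat) set \<Rightarrow> nat \<Rightarrow> int" where
  "potential D j = column_potential ((1, j - 1) \<in> D) ((2, j - 1) \<in> D) ((3, j - 1) \<in> D)
     ((1, j) \<in> D) ((2, j) \<in> D) ((3, j) \<in> D)"

text \<open>A finite check. The last three premises are what the domination of the next column
  implies when nothing is known about the column after it: of two required neighbours at most one
  lies there.\<close>

lemma column_potential_step:
  assumes "a \<or> of_bool b + of_bool a' + of_bool a'' \<ge> (2::nat)"
    and "b \<or> of_bool a + of_bool c + of_bool b' + of_bool b'' \<ge> (2::nat)"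
    and "c \<or> of_bool b + of_bool c' + of_bool c'' \<ge> (2::nat)"
    and "a'' \<or> b'' \<or> a" "b'' \<or> a'' \<or> c'' \<or> b" "c'' \<or> b'' \<or> c"
  shows "column_potential a' b' c' a b c + 4
    \<le> 3 * (of_bool a'' + of_bool b'' + of_bool c'') + column_potential a b c a'' b'' c''"
  using assms unfolding column_potential_def
  by (cases a; cases b; cases c; cases a'; cases b'; cases c'; cases a''; cases b''; cases c''; simp)

lemma column_potential_final:
  assumes "a \<or> of_bool b + of_bool a' \<ge> (2::nat)"
    and "b \<or> of_bool a + of_bool c + of_bool b' \<ge> (2::nat)"
    and "c \<or> of_bool b + of_bool c' \<ge> (2::nat)"
  shows "column_potential a' b' c' a b c \<le> 0"
  using assms unfolding column_potential_def
  by (cases a; cases b; cases c; cases a'; cases b'; cases c'; simp)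

text \<open>Start value for the grid without the edge (1,1)(1,2). The summand 1 in the first premise
  is (1,1), which lies in \<open>D\<close>; the argument \<open>False\<close> hides it from column
  2. With the 3 paid for (1,1) the total is 10 = 4 * 2 + 2.\<close>

lemma column_potential_corner:
  assumes "b' \<or> 1 + of_bool c' + of_bool b \<ge> (2::nat)"
    and "c' \<or> of_bool b' + of_bool c \<ge> (2::nat)"
    and "a \<or> of_bool b + of_bool a'' \<ge> (2::nat)"
    and "b \<or> of_bool a + of_bool c + of_bool b' + of_bool b'' \<ge> (2::nat)"
    and "c \<or> of_bool b + of_bool c' + of_bool c'' \<ge> (2::nat)"
  shows "7 \<le> column_potential False b' c' a b c
    + 3 * (of_bool b' + of_bool c' + of_bool a + of_bool b + of_bool c)"
  using assms unfolding column_potential_def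
  by (cases a; cases b; cases c; cases b'; cases c'; cases a''; cases b''; cases c''; simp)

text \<open>Induction from the last column back to \<open>k\<close>. The potential is at most 0 at
  column n because column n + 1 is empty, and every earlier column gains 4.\<close>

lemma potential_le_tail:
  assumes "k \<le> n" "\<And>j. k \<le> j \<Longrightarrow> j \<le> n \<Longrightarrow> dom_column D j"
    and "(1, Suc n) \<notin> D" "(2, Suc n) \<notin> D" "(3, Suc n) \<notin> D"
  shows "4 * int (n - k) + potential D k \<le>
    3 * int (\<Sum>j = Suc k..n. of_bool ((1, j) \<in> D) + of_bool ((2, j) \<in> D) + of_bool ((3, j) \<in> D))"
  using assms(1,2)
proof (induction k rule: inc_induct)
  case base
  then have "dom_column D n"
    by simp
  then show ?case
    using assms(3-) column_potential_final by (simp add: dom_column_def potential_def)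
next
  case (step k)
  have "dom_column D k" "dom_column D (Suc k)"
    using step by simp_all
  then have "potential D k + 4 \<le> 3 * (of_bool ((1, Suc k) \<in> D) + of_bool ((2, Suc k) \<in> D)
      + of_bool ((3, Suc k) \<in> D)) + potential D (Suc k)"
    unfolding dom_column_def potential_def Suc_eq_plus1 add_diff_cancel_right'
    by (intro column_potential_step) (auto simp: of_bool_def split: if_splits)
  moreover have "int (n - k) = int (n - Suc k) + 1"
    using step.hyps by simp
  moreover have "{Suc k..n} = insert (Suc k) {Suc (Suc k)..n}"
    using step.hyps by auto
  ultimately show ?case
    using step.IH step.prems step.hyps by simp
qed

section \<open>From 2-domination in a subgraph of the grid to conditions on columns\<close>

lemma two_dominatingD:
  assumes "two_dominating V E D" "v \<in> V" "v \<notin> D" "finite T" "\<And>u. {v, u} \<in> E \<Longrightarrow> u \<in> T"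
  shows "2 \<le> (\<Sum>u \<in> T. of_bool (u \<in> D \<and> {v, u} \<in> E) :: nat)"
proof -
  have "2 \<le> card (neighbours E v \<inter> D)"
    using assms(1-3) by (auto simp: two_dominating_def)
  also have "neighbours E v \<inter> D = {u \<in> T. u \<in> D \<and> {v, u} \<in> E}"
    using assms(5) by (auto simp: neighbours_def)
  also have "card \<dots> = (\<Sum>u \<in> T. of_bool (u \<in> D \<and> {v, u} \<in> E))"
    using assms(4) by (simp add: Int_def)
  finally show ?thesis .
qed

lemma grid3_top_neighbour:
  "{(1, j), u} \<in> grid_edges 3 n \<Longrightarrow> u \<in> {(2, j), (1, j - 1), (1, j + 1)}"
  by (cases u) (auto simp: grid_edges_iff grid_verts_def)

lemma grid3_middle_neighbour:
  "{(2, j), u} \<in> grid_edges 3 n \<Longrightarrow> u \<in> {(1, j), (3, j), (2, j - 1), (2, j + 1)}"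
  by (cases u) (auto simp: grid_edges_iff grid_verts_def)

lemma grid3_bottom_neighbour:
  "{(3, j), u} \<in> grid_edges 3 n \<Longrightarrow> u \<in> {(2, j), (3, j - 1), (3, j + 1)}"
  by (cases u) (auto simp: grid_edges_iff grid_verts_def)

context
  fixes n j :: nat and E :: "(nat \<times> nat) set set" and D :: "(nat \<times> nat) set"
  assumes dom: "two_dominating (grid_verts 3 n) E D" and sub: "E \<subseteq> grid_edges 3 n"
    and j: "1 \<le> j" "j \<le> n"
begin

text \<open>Each summand keeps its edge condition, so that a removed edge visibly contributes
  0.\<close>

lemma two_dominating_top:
  assumes "(1, j) \<notin> D"
  shows "2 \<le> of_bool ((2, j) \<in> D \<and> {(1, j), (2, j)} \<in> E)
     + of_bool ((1, j - 1) \<in> D \<and> {(1, j), (1, j - 1)} \<in> E)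
     + (of_bool ((1, j + 1) \<in> D \<and> {(1, j), (1, j + 1)} \<in> E) :: nat)"
  using two_dominatingD[OF dom _ assms, of "{(2, j), (1, j - 1), (1, j + 1)}"]
    subsetD[OF sub, THEN grid3_top_neighbour] j
  by (simp add: grid_verts_def add.assoc del: sum_of_bool_eq)

lemma two_dominating_middle:
  assumes "(2, j) \<notin> D"
  shows "2 \<le> of_bool ((1, j) \<in> D \<and> {(2, j), (1, j)} \<in> E)
     + of_bool ((3, j) \<in> D \<and> {(2, j), (3, j)} \<in> E)
     + of_bool ((2, j - 1) \<in> D \<and> {(2, j), (2, j - 1)} \<in> E)
     + (of_bool ((2, j + 1) \<in> D \<and> {(2, j), (2, j + 1)} \<in> E) :: nat)"
  using two_dominatingD[OF dom _ assms, of "{(1, j), (3, j), (2, j - 1), (2, j + 1)}"]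
    subsetD[OF sub, THEN grid3_middle_neighbour] j
  by (simp add: grid_verts_def add.assoc del: sum_of_bool_eq)

lemma two_dominating_bottom:
  assumes "(3, j) \<notin> D"
  shows "2 \<le> of_bool ((2, j) \<in> D \<and> {(3, j), (2, j)} \<in> E)
     + of_bool ((3, j - 1) \<in> D \<and> {(3, j), (3, j - 1)} \<in> E)
     + (of_bool ((3, j + 1) \<in> D \<and> {(3, j), (3, j + 1)} \<in> E) :: nat)"
  using two_dominatingD[OF dom _ assms, of "{(2, j), (3, j - 1), (3, j + 1)}"]
    subsetD[OF sub, THEN grid3_bottom_neighbour] j
  by (simp add: grid_verts_def add.assoc del: sum_of_bool_eq)

text \<open>Dropping the edge conditions only enlarges the sums.\<close>

lemma dom_column_if_two_dominating: "dom_column D j"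
  unfolding dom_column_def
  by (intro conjI disjCI)
    (force intro: order_trans[OF two_dominating_top] order_trans[OF two_dominating_middle]
      order_trans[OF two_dominating_bottom] add_mono)+

end

text \<open>\<open>D'\<close> may differ from \<open>D\<close> to the left of column
  \<open>k\<close>. This allows the columns from \<open>k\<close> on to be treated as if a useless
  vertex of \<open>D\<close> were absent, while that vertex is still counted.\<close>

lemma card_two_dominating_ge_potential:
  assumes "two_dominating (grid_verts 3 n) E D" "E \<subseteq> grid_edges 3 n" "k \<le> n"
    and "\<And>j. k \<le> j \<Longrightarrow> j \<le> n \<Longrightarrow> dom_column D' j"
    and "\<And>i j. k \<le> j \<Longrightarrow> (i, j) \<in> D' \<longleftrightarrow> (i, j) \<in> D"
  shows "4 * int (n - k) + potential D' k +
    3 * int (\<Sum>j = 1..k. of_bool ((1, j) \<in> D) + of_bool ((2, j) \<in> D) + of_bool ((3, j) \<in> D))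
    \<le> 3 * int (card D)"
proof -
  let ?f = "\<lambda>j. of_bool ((1, j) \<in> D) + of_bool ((2, j) \<in> D) + of_bool ((3, j) \<in> D) :: nat"
  have D: "D \<subseteq> grid_verts 3 n"
    using assms(1) by (simp add: two_dominating_def)
  have out: "(i, Suc n) \<notin> D'" for i
    using D assms(3,5) by (auto simp: grid_verts_def)
  have "card D = (\<Sum>j = 1..k. ?f j) + (\<Sum>j = Suc k..n. ?f j)"
    using assms(3) sum.ub_add_nat[of 1 k ?f "n - k"] by (simp add: card_subset_grid3[OF D])
  moreover have "(\<Sum>j = Suc k..n. ?f j)
      = (\<Sum>j = Suc k..n. of_bool ((1, j) \<in> D') + of_bool ((2, j) \<in> D') + of_bool ((3, j) \<in> D'))"
    using assms(5) by (intro sum.cong) auto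
  ultimately show ?thesis
    using potential_le_tail[OF assms(3,4) out out out] by simp
qed

section \<open>Lower bounds for the grid and for two grids with removed edges\<close>

lemma card_two_dominating_grid3_ge:
  assumes "two_dominating (grid_verts 3 n) (grid_edges 3 n) D" "1 \<le> n"
  shows "4 * n \<le> 3 * card D"
proof -
  note c = dom_column_if_two_dominating[OF assms(1) order_refl]
  have "\<not> (i, 0) \<in> D" for i
    using assms(1) by (auto simp: two_dominating_def grid_verts_def)
  \<comment> \<open>The first column pays for itself; the other n - 1 columns add 4 each.\<close>
  then have "4 \<le> potential D 1 + 3 * (of_bool ((1, 1) \<in> D) + of_bool ((2, 1) \<in> D) + of_bool ((3, 1) \<in> D))"
    using c[of 1] assms(2) by (auto simp: dom_column_def potential_def column_potential_def)
  then show ?thesis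
    using card_two_dominating_ge_potential[OF assms(1) order_refl, of 1 D] c assms(2) by simp
qed

lemma card_two_dominating_remove_corner_edge_ge:
  assumes "two_dominating (grid_verts 3 n) (grid_edges 3 n - {{(1, 1), (1, 2)}}) D" "2 \<le> n"
  shows "4 * n + 2 \<le> 3 * card D"
proof -
  let ?E = "grid_edges 3 n - {{(1, 1), (1, 2)}}" and ?D' = "D - {(1, 1)}"
  have sub: "?E \<subseteq> grid_edges 3 n"
    by blast
  note c = dom_column_if_two_dominating[OF assms(1) sub]
  have 0: "\<not> (i, 0) \<in> D" for i
    using assms(1) by (auto simp: two_dominating_def grid_verts_def)
  \<comment> \<open>The only remaining neighbour of (1,1) is (2,1).\<close>
  have a: "(1, 1) \<in> D"
  proof (rule ccontr)
    assume "(1, 1) \<notin> D"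
    from two_dominating_top[OF assms(1) sub _ _ this] show False
      using assms(2) 0
      by (auto simp: of_bool_def numeral_2_eq_2 split: if_splits)
  qed
  have "{(1, 2), (1, 1)} \<notin> ?E"
    by (simp add: insert_commute)
  then have "(1, 2) \<in> D \<or> of_bool ((2, 2) \<in> D) + of_bool ((1, 3) \<in> D) \<ge> (2::nat)"
    using two_dominating_top[OF assms(1) sub, of 2] assms(2)
    by (cases "(1, 2) \<in> D") (auto simp: of_bool_def split: if_splits)
  moreover have "dom_column D 2"
    using c[of 2] assms(2) by simp
  \<comment> \<open>Since (1,2) has lost its edge to (1,1), it is dominated without that vertex; the
    other two rows do not see (1,1).\<close>
  ultimately have c2: "dom_column ?D' 2"
    by (simp add: dom_column_def)
  have c': "dom_column ?D' j" if "2 \<le> j" "j \<le> n" for j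
  proof (cases "j = 2")
    case False
    then have "dom_column ?D' j \<longleftrightarrow> dom_column D j"
      using that by (simp add: dom_column_def)
    then show ?thesis
      using c that by simp
  qed (use c2 in simp)
  have "7 \<le> potential ?D' 2 + 3 * (of_bool ((2, 1) \<in> D) + of_bool ((3, 1) \<in> D)
     + of_bool ((1, 2) \<in> D) + of_bool ((2, 2) \<in> D) + of_bool ((3, 2) \<in> D))"
    using column_potential_corner[of "(2, 1) \<in> D" "(3, 1) \<in> D" "(2, 2) \<in> D" "(3, 2) \<in> D"
        "(1, 2) \<in> D" "(1, 3) \<in> D" "(2, 3) \<in> D" "(3, 3) \<in> D"] c[of 1] c2 a 0 assms(2)
    by (simp add: dom_column_def potential_def numeral_2_eq_2 numeral_3_eq_3)
  moreover have "{1..2} = {1, 2 :: nat}"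
    by auto
  ultimately show ?thesis
    using card_two_dominating_ge_potential[OF assms(1) sub, of 2 ?D'] c' a assms(2) by simp
qed

lemma card_two_dominating_remove_side_edges_ge:
  assumes "two_dominating (grid_verts 3 n) (grid_edges 3 n - {{(1, 1), (2, 1)}, {(2, 1), (3, 1)}}) D" "1 \<le> n"
  shows "4 * n + 4 \<le> 3 * card D"
proof -
  let ?E = "grid_edges 3 n - {{(1, 1), (2, 1)}, {(2, 1), (3, 1)}}"
  have sub: "?E \<subseteq> grid_edges 3 n"
    by blast
  note c = dom_column_if_two_dominating[OF assms(1) sub]
  have 0: "\<not> (i, 0) \<in> D" for i
    using assms(1) by (auto simp: two_dominating_def grid_verts_def)
  have E: "{(1, 1), (2, 1)} \<notin> ?E" "{(2, 1), (1, 1)} \<notin> ?E" "{(2, 1), (3, 1)} \<notin> ?E" "{(3, 1), (2, 1)} \<notin> ?E"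
    by (simp_all add: insert_commute)
  have "(1, 1) \<in> D"
  proof (rule ccontr)
    assume "(1, 1) \<notin> D"
    from two_dominating_top[OF assms(1) sub _ _ this] show False
      using assms(2) 0 E
      by (auto simp: of_bool_def split: if_splits)
  qed
  moreover have "(2, 1) \<in> D"
  proof (rule ccontr)
    assume "(2, 1) \<notin> D"
    from two_dominating_middle[OF assms(1) sub _ _ this] show False
      using assms(2) 0 E
      by (auto simp: of_bool_def split: if_splits)
  qed
  moreover have "(3, 1) \<in> D"
  proof (rule ccontr)
    assume "(3, 1) \<notin> D"
    from two_dominating_bottom[OF assms(1) sub _ _ this] show False
      using assms(2) 0 E
      by (auto simp: of_bool_def split: if_splits)
  qed
  \<comment> \<open>A full first column after an empty one has potential -1, so it accounts for 3 *
    3 - 1 = 8 = 4 + 4.\<close>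
  ultimately show ?thesis
    using card_two_dominating_ge_potential[OF assms(1) sub, of 1 D] c assms(2)
    by (simp add: potential_def column_potential_def)
qed

section \<open>Upper bounds\<close>

text \<open>The wide columns carry \<open>{1,3}\<close>, the others \<open>{2}\<close>; for \<open>x > n + 1\<close> no column is inserted.\<close>
definition wide_column :: "nat \<Rightarrow> nat \<Rightarrow> bool" where
  "wide_column x j \<longleftrightarrow> j < x \<and> j mod 3 = 2 \<or> j = x \<or> x < j \<and> j mod 3 = 0"

definition pattern :: "nat \<Rightarrow> nat \<Rightarrow> (nat \<times> nat) set" where
  "pattern x n = {(i, j) \<in> grid_verts 3 n. wide_column x j \<longleftrightarrow> i \<noteq> 2}"

text \<open>For x = 3q + 1 there are q wide columns before x, namely 2, 5, ..., 3q - 1, as many as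
  there are multiples of 3 up to x. Hence from x on the count is that of the multiples of 3, plus
  one for x itself.\<close>

lemma sum_wide_column:
  assumes "x mod 3 = 1"
  shows "(\<Sum>j = 1..m. of_bool (wide_column x j)) = (if m < x then Suc m div 3 else Suc (m div 3))"
proof (induction m)
  case 0
  show ?case using assms by (cases x) auto
next
  case (Suc m)
  have "(\<Sum>j = 1..Suc m. of_bool (wide_column x j))
      = (if m < x then Suc m div 3 else Suc (m div 3)) + of_bool (wide_column x (Suc m))"
    using Suc by (simp del: sum_of_bool_eq)
  also have "\<dots> = (if Suc m < x then Suc (Suc m) div 3 else Suc (Suc m div 3))"
  proof -
    consider "Suc m < x" | "Suc m = x" | "x \<le> m"
      by linarith
    then show ?thesis
    proof cases
      case 1
      then show ?thesis
        by (auto simp: wide_column_def div_Suc mod_Suc)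
    next
      case 2
      then have "m mod 3 = 0"
        using assms by (auto simp: mod_Suc split: if_splits)
      then show ?thesis
        using 2 by (auto simp: wide_column_def div_Suc mod_Suc)
    next
      case 3
      then show ?thesis
        by (auto simp: wide_column_def div_Suc mod_Suc)
    qed
  qed
  finally show ?case .
qed

lemma card_pattern:
  assumes "x mod 3 = 1"
  shows "card (pattern x n) = n + (if n < x then Suc n div 3 else Suc (n div 3))"
proof -
  have "card (pattern x n) = (\<Sum>j = 1..n. of_bool ((1, j) \<in> pattern x n)
      + of_bool ((2, j) \<in> pattern x n) + of_bool ((3, j) \<in> pattern x n))"
    by (intro card_subset_grid3) (auto simp: pattern_def)
  also have "\<dots> = (\<Sum>j = 1..n. 1 + of_bool (wide_column x j))"
    by (intro sum.cong) (auto simp: pattern_def grid_verts_def)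
  also have "\<dots> = n + (\<Sum>j = 1..n. of_bool (wide_column x j))"
    by (simp only: sum.distrib) simp
  finally show ?thesis
    by (simp only: sum_wide_column[OF assms])
qed

section \<open>How often the patterns dominate each vertex\<close>

lemma card_neighbours_ge:
  assumes "finite D" "U \<subseteq> neighbours E v \<inter> D"
  shows "card U \<le> card (neighbours E v \<inter> D)"
  using assms by (intro card_mono) auto

lemma finite_pattern: "finite (pattern x n)"
  by (rule finite_subset[OF _ finite_grid_verts[of 3 n]]) (auto simp: pattern_def)

lemma pattern_dominates_middle:
  assumes "wide_column x j" "1 \<le> j" "j \<le> n" "2 \<le> n" "x mod 3 = 1"
  shows "3 \<le> card (neighbours (grid_edges 3 n) (2, j) \<inter> pattern x n)"
proof -
  \<comment> \<open>Wide columns are never adjacent, so the column to the left supplies the third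
    neighbour. Column 1 is wide only for x = 1, and then column 2 serves.\<close>
  obtain j' where j': "j = j' + 1 \<or> j' = j + 1" "1 \<le> j'" "j' \<le> n" "\<not> wide_column x j'"
  proof (cases "j = 1")
    case True
    moreover from this have "x = 1"
      using assms(1) by (auto simp: wide_column_def)
    ultimately show ?thesis
      using that[of 2] assms(4) by (simp add: wide_column_def)
  next
    case False
    then obtain i where "j = Suc i"
      using assms(2) by (cases j) auto
    then have "\<not> wide_column x (j - 1)"
      using assms(1,5) by (auto simp: wide_column_def mod_Suc split: if_splits)
    then show ?thesis
      using that[of "j - 1"] False assms by simp
  qed
  have "{(1, j), (3, j), (2, j')} \<subseteq> neighbours (grid_edges 3 n) (2, j) \<inter> pattern x n"
    using assms j' by (auto simp: neighbours_def grid_edges_iff grid_verts_def pattern_def)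
  from card_neighbours_ge[OF finite_pattern this] show ?thesis
    by simp
qed

text \<open>Besides (2,j), the neighbours come from adjacent wide columns. Next to x there is one on
  both sides, as x - 2 = 2 and x + 2 = 0 modulo 3. The condition on n ensures that the needed
  columns exist: without an inserted column, a last column n = 1 modulo 3 would have no wide
  neighbour.\<close>

lemma pattern_dominates_outer:
  assumes "i = 1 \<or> i = 3" "\<not> wide_column x j" "1 \<le> j" "j \<le> n" "x mod 3 = 1"
    and "x \<le> n \<and> n mod 3 = 1 \<or> n + 1 < x \<and> n mod 3 \<noteq> 1"
  shows "(if j + 1 = x \<or> x + 1 = j then 3 else 2) \<le> card (neighbours (grid_edges 3 n) (i, j) \<inter> pattern x n)"
proof -
  let ?P = "\<lambda>j'. 1 \<le> j' \<and> j' \<le> n \<and> wide_column x j'"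
  have "(j + 1 = x \<or> x + 1 = j \<longrightarrow> ?P (j - 1) \<and> ?P (j + 1)) \<and> (?P (j - 1) \<or> ?P (j + 1))"
  proof -
    obtain i where i: "j = Suc i"
      using assms(3) by (cases j) auto
    obtain q where x: "x = 3 * q + 1"
      using assms(5) by (metis div_mod_decomp mult.commute)
    consider "j + 1 = x" | "j = x + 1" | "j + 1 < x" | "x + 1 < j"
      using assms(2) unfolding wide_column_def by linarith
    then show ?thesis
    proof cases
      case 1
      then have "Suc (Suc i) mod 3 = 1" using assms(5) i by simp
      then show ?thesis
        using assms(2-) 1 i by (cases i) (auto simp: wide_column_def mod_Suc split: if_splits)
    next
      case 2
      then have *: "Suc j mod 3 = 0" "j mod 3 = 2"
        using x by presburger+
      then have "j \<noteq> n" using assms(6) 2 by auto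
      then show ?thesis
        using assms(3-) 2 * by (auto simp: wide_column_def)
    next
      case 3
      then show ?thesis
        using assms(2-4,6) i by (cases i; cases "j = n") (auto simp: wide_column_def mod_Suc split: if_splits)
    next
      case 4
      then show ?thesis
        using assms(2-4,6) i by (cases i; cases "j = n") (auto simp: wide_column_def mod_Suc split: if_splits)
    qed
  qed
  moreover have "card (insert (2, j) {(i, j') | j'. (j = j' + 1 \<or> j' = j + 1) \<and> ?P j'})
     \<le> card (neighbours (grid_edges 3 n) (i, j) \<inter> pattern x n)"
    using assms
    by (intro card_neighbours_ge finite_pattern)
      (auto simp: neighbours_def grid_edges_iff grid_verts_def pattern_def)
  moreover have "{(i, j') | j'. (j = j' + 1 \<or> j' = j + 1) \<and> ?P j'}
     = (if ?P (j - 1) then {(i, j - 1)} else {}) \<union> (if ?P (j + 1) then {(i, j + 1)} else {})"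
    using assms(3) by auto
  ultimately show ?thesis
    using assms(1,3) by (auto split: if_splits)
qed

lemma pattern_dominates:
  assumes "v \<in> grid_verts 3 n - pattern x n" "x mod 3 = 1" "x \<le> n \<and> n mod 3 = 1 \<or> n + 1 < x \<and> n mod 3 \<noteq> 1"
    and "2 \<le> n"
  shows "2 \<le> card (neighbours (grid_edges 3 n) v \<inter> pattern x n)"
    and "snd v + 1 = x \<or> snd v = x \<or> snd v = x + 1 \<or> wide_column x (snd v) \<Longrightarrow>
      3 \<le> card (neighbours (grid_edges 3 n) v \<inter> pattern x n)"
proof -
  obtain i j where v: "v = (i, j)"
    by (cases v)
  have ij: "1 \<le> j" "j \<le> n" "i = 2 \<and> wide_column x j \<or> (i = 1 \<or> i = 3) \<and> \<not> wide_column x j"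
    using assms(1) by (auto simp: v pattern_def grid_verts_def)
  show "2 \<le> card (neighbours (grid_edges 3 n) v \<inter> pattern x n)"
    using pattern_dominates_middle[of x j n] pattern_dominates_outer[of i x j n] ij assms(2-)
    unfolding v by (auto split: if_splits)
  assume "snd v + 1 = x \<or> snd v = x \<or> snd v = x + 1 \<or> wide_column x (snd v)"
  moreover have "wide_column x x"
    by (simp add: wide_column_def)
  ultimately show "3 \<le> card (neighbours (grid_edges 3 n) v \<inter> pattern x n)"
    using pattern_dominates_middle[of x j n] pattern_dominates_outer[of i x j n] ij assms(2-)
    unfolding v by (auto split: if_splits)
qed

section \<open>Upper bounds from the patterns, with and without a removed edge\<close>

lemma two_dominating_remove_edge:
  assumes "two_dominating V E D" "finite D"
    and "\<And>v. v \<in> V - D \<Longrightarrow> v \<in> e \<Longrightarrow> 3 \<le> card (neighbours E v \<inter> D)"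
    and "card e = 2"
  shows "two_dominating V (E - {e}) D"
  unfolding two_dominating_def
proof (intro conjI ballI)
  show "D \<subseteq> V"
    using assms(1) by (simp add: two_dominating_def)
next
  fix v assume v: "v \<in> V - D"
  show "2 \<le> card (neighbours (E - {e}) v \<inter> D)"
  proof (cases "v \<in> e")
    case False
    then have "neighbours (E - {e}) v = neighbours E v"
      by (auto simp: neighbours_def)
    then show ?thesis
      using assms(1) v by (simp add: two_dominating_def)
  next
    case True
    then obtain w where "e = {v, w}"
      using assms(4) by (auto simp: card_2_iff)
    then have "neighbours E v \<inter> D - {w} \<subseteq> neighbours (E - {e}) v \<inter> D"
      by (auto simp: neighbours_def doubleton_eq_iff)
    then have "card (neighbours E v \<inter> D - {w}) \<le> card (neighbours (E - {e}) v \<inter> D)"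
      using assms(2) by (intro card_mono) auto
    moreover have "card (neighbours E v \<inter> D) - 1 \<le> card (neighbours E v \<inter> D - {w})"
      by (simp add: card_Diff_singleton_if)
    ultimately show ?thesis
      using assms(3)[OF v True] by simp
  qed
qed

lemma two_dominating_pattern:
  assumes "x mod 3 = 1" "x \<le> n \<and> n mod 3 = 1 \<or> n + 1 < x \<and> n mod 3 \<noteq> 1" "2 \<le> n"
  shows "two_dominating (grid_verts 3 n) (grid_edges 3 n) (pattern x n)"
  using pattern_dominates(1)[OF _ assms] by (auto simp: two_dominating_def pattern_def)

text \<open>Take for x whichever of j - 1, j, j + 1 is 1 modulo 3. If it is j - 1, then j + 1 is a
  multiple of 3 to the right of x and hence wide. If it is j + 1, it is still at most n because n =
  1 modulo 3.\<close>

lemma ex_good_column: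
  fixes j j' n :: nat
  assumes "n mod 3 = 1" "j \<le> n" "1 \<le> j" "j' = j \<or> j' = j + 1" "j' \<le> n"
  shows "\<exists>x. x mod 3 = 1 \<and> x \<le> n \<and> (\<forall>k \<in> {j, j'}. k + 1 = x \<or> k = x \<or> k = x + 1 \<or> wide_column x k)"
proof -
  consider "j mod 3 = 1" | "j mod 3 = 2" | "j mod 3 = 0"
    by linarith
  then show ?thesis
  proof cases
    case 1
    then show ?thesis
      using assms by (intro exI[of _ j]) auto
  next
    case 2
    then have "(j - 1) mod 3 = 1" "(j + 1) mod 3 = 0"
      by (cases j; auto simp: mod_Suc split: if_splits)+
    then show ?thesis
      using assms by (intro exI[of _ "j - 1"]) (auto simp: wide_column_def)
  next
    case 3
    then have "j \<noteq> n"
      using assms(1) by auto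
    then have "(j + 1) mod 3 = 1" "j + 1 \<le> n"
      using 3 assms(2) by (auto simp: mod_Suc)
    then show ?thesis
      using assms by (intro exI[of _ "j + 1"]) auto
  qed
qed

text \<open>The size of the pattern is the same for all x up to n, so x can be fitted to
  \<open>e\<close> at no cost: both endpoints are then in the pattern or dominated three
  times.\<close>

lemma two_domination_number_remove_edge_le:
  assumes "n mod 3 = 1" "2 \<le> n" "e \<in> grid_edges 3 n"
  shows "two_domination_number (grid_verts 3 n) (grid_edges 3 n - {e}) \<le> n + Suc (n div 3)"
proof -
  obtain i j i' j' where e: "e = {(i, j), (i', j')}"
      "(i, j) \<in> grid_verts 3 n" "(i', j') \<in> grid_verts 3 n" "\<bar>int i - int i'\<bar> + \<bar>int j - int j'\<bar> = 1"
    using assms(3) unfolding grid_edges_def by blast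
  then have "j' = j \<or> j' = j + 1 \<or> j = j' + 1"
    by linarith
  then obtain x where x: "x mod 3 = 1" "x \<le> n"
      "\<forall>k \<in> {j, j'}. k + 1 = x \<or> k = x \<or> k = x + 1 \<or> wide_column x k"
    using ex_good_column[of n j j'] ex_good_column[of n j' j] e(2,3) assms(1)
    by (auto simp: grid_verts_def)
  have dom: "two_dominating (grid_verts 3 n) (grid_edges 3 n) (pattern x n)"
    using x assms by (intro two_dominating_pattern) auto
  have "two_dominating (grid_verts 3 n) (grid_edges 3 n - {e}) (pattern x n)"
  proof (rule two_dominating_remove_edge[OF dom finite_pattern])
    fix v assume v: "v \<in> grid_verts 3 n - pattern x n" "v \<in> e"
    then have "snd v \<in> {j, j'}"
      by (auto simp: e(1))
    then show "3 \<le> card (neighbours (grid_edges 3 n) v \<inter> pattern x n)"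
      using x assms v(1) by (intro pattern_dominates(2)) auto
  qed (use e in \<open>auto simp: card_insert_if\<close>)
  from two_domination_number_le[OF finite_grid_verts this] show ?thesis
    using x by (simp add: card_pattern)
qed

lemma two_domination_number_grid3_le:
  assumes "n mod 3 \<noteq> 1" "2 \<le> n"
  shows "two_domination_number (grid_verts 3 n) (grid_edges 3 n) \<le> n + Suc n div 3"
proof -
  \<comment> \<open>Some x = 1 modulo 3 beyond n + 1, which yields the periodic pattern without
    insertion.\<close>
  have "(3 * n + 1) mod 3 = 1"
    by presburger
  then show ?thesis
    using two_domination_number_le[OF finite_grid_verts two_dominating_pattern[of "3 * n + 1" n]] assms
    by (simp add: card_pattern)
qed

section \<open>The bondage number\<close>

lemma two_bondage_number_eqI:
  assumes "B \<subseteq> E" "two_domination_number V (E - B) > two_domination_number V E"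
    and "\<And>B'. B' \<subseteq> E \<Longrightarrow> card B' < card B \<Longrightarrow>
      two_domination_number V (E - B') \<le> two_domination_number V E"
  shows "two_bondage_number V E = card B"
  unfolding two_bondage_number_def
proof (rule cInf_eq_minimum)
  fix m assume "m \<in> {card B |B. B \<subseteq> E \<and> two_domination_number V (E - B) > two_domination_number V E}"
  then show "card B \<le> m"
    using assms(3) by (force simp: not_less[symmetric])
qed (use assms(1,2) in auto)

theorem theorem3:
  fixes n :: nat
  assumes "n \<ge> 2"
  shows "two_bondage_number (grid_verts 3 n) (grid_edges 3 n) = (if n mod 3 = 1 then 2 else 1)"
proof (cases "n mod 3 = 1")
  case True
  let ?B = "{{(1, 1), (2, 1)}, {(2, 1), (3, 1)}} :: (nat \<times> nat) set set"
  obtain k where n: "n = 3 * k + 1"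
    using True by (metis div_mod_decomp mult.commute)
  have B: "card ?B = 2"
    by (simp add: doubleton_eq_iff)
  have "two_domination_number (grid_verts 3 n) (grid_edges 3 n) \<le> 4 * k + 2"
    using two_domination_number_le[OF finite_grid_verts two_dominating_pattern[of n n]] True assms n
    by (simp add: card_pattern)
  \<comment> \<open>From 3|D| \<ge> 4n + 4 = 12k + 8 by rounding up.\<close>
  moreover have "4 * k + 3 \<le> two_domination_number (grid_verts 3 n) (grid_edges 3 n - ?B)"
    using card_two_dominating_remove_side_edges_ge assms n
    by (intro two_domination_number_ge finite_grid_verts) fastforce
  moreover have "?B \<subseteq> grid_edges 3 n"
    using assms by (auto simp: grid_edges_iff grid_verts_def)
  moreover have "two_domination_number (grid_verts 3 n) (grid_edges 3 n - B')
      \<le> two_domination_number (grid_verts 3 n) (grid_edges 3 n)"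
    if "B' \<subseteq> grid_edges 3 n" "card B' < card ?B" for B'
  proof -
    \<comment> \<open>Needed because \<open>card\<close> is 0 on infinite sets as well.\<close>
    have "finite B'"
      using that(1) finite_grid_edges by (rule finite_subset)
    moreover have "card B' = 0 \<or> card B' = 1"
      using that(2) B by linarith
    ultimately consider "B' = {}" | e where "B' = {e}"
      by (auto simp: card_1_singleton_iff)
    then show ?thesis
    proof cases
      case 2
      have "4 * k + 2 \<le> two_domination_number (grid_verts 3 n) (grid_edges 3 n)"
        using card_two_dominating_grid3_ge assms n
        by (intro two_domination_number_ge finite_grid_verts) fastforce
      then show ?thesis
        using two_domination_number_remove_edge_le[OF True assms, of e] 2 that(1) n by simp
    qed simp
  qed
  ultimately show ?thesis
    using two_bondage_number_eqI[of ?B "grid_edges 3 n" "grid_verts 3 n"] B True by simp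
next
  case False
  let ?B = "{{(1, 1), (1, 2)}} :: (nat \<times> nat) set set"
  have "two_domination_number (grid_verts 3 n) (grid_edges 3 n) \<le> n + Suc n div 3"
    using two_domination_number_grid3_le[OF False assms] .
  moreover have "n + Suc n div 3 + 1 \<le> two_domination_number (grid_verts 3 n) (grid_edges 3 n - ?B)"
  proof (intro two_domination_number_ge finite_grid_verts)
    fix D assume "two_dominating (grid_verts 3 n) (grid_edges 3 n - ?B) D"
    from card_two_dominating_remove_corner_edge_ge[OF this assms]
    show "n + Suc n div 3 + 1 \<le> card D"
      \<comment> \<open>Rounding up (4n + 2)/3 gives 4k + 1 for n = 3k and 4k + 4 for n = 3k + 2,
        one more than the pattern has. For n = 3k + 1 it would give only 4k + 2, the value for the
        grid itself.\<close>
      using False by linarith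
  qed
  moreover have "?B \<subseteq> grid_edges 3 n"
    using assms by (auto simp: grid_edges_iff grid_verts_def)
  moreover have "two_domination_number (grid_verts 3 n) (grid_edges 3 n - B')
      \<le> two_domination_number (grid_verts 3 n) (grid_edges 3 n)"
    if "B' \<subseteq> grid_edges 3 n" "card B' < card ?B" for B'
    using that finite_subset[OF that(1) finite_grid_edges] by simp
  ultimately show ?thesis
    using two_bondage_number_eqI[of ?B "grid_edges 3 n" "grid_verts 3 n"] False by simp
qed

end
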